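(* Let $E=\mathbb{R}^{3\times 3}_{\rm sym}$, $F=E^*$, let $T>0$ be a fixed time horizon, and let $\mathbb{C}\in L(E,F)$ and a measurable hereditary kernel $\mathbb{K}:\mathbb{R}\to L(E,F)$ satisfy the standing assumptions stated in the context. Assume: (i) (Elastic stability) $\mathbb{C}^T=\mathbb{C}$ and $\mathbb{C}>0$; (ii) (Fading memory) there is a positive, continuous, non-increasing, integrable weighting function $w:[0,+\infty)\to\mathbb{R}$ with $w(0)=1$ satisfying the semigroup condition $w(s)\ge w(s-t)\,w(t)$ (for $0\le t\le s$), and a constant $\gamma<1$ such that $$\int_0^{+\infty}\|\mathbb{K}(\tau)\|\,w^{-1}(\tau)\,d\tau\le\gamma,$$ where $\|\cdot\|$ is the operator norm; (iii) (Stress regularity) $\sigma\in\mathcal{N}$. Then the variational problem: find $\epsilon\in\mathcal{M}$ with $$a(\epsilon,\eta)=\int_{-\infty}^T\sigma(t)\cdot\eta(t)\,d\mu(t)\quad\text{for all }\eta\in\mathcal{M}$$ has a unique solution $\epsilon\in\mathcal{M}$, and $\|\epsilon\|_{\mathcal{M}}\le\frac{1}{1-\gamma}\|\sigma\|_{\mathcal{N}}$.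
   Context: Standing assumptions on the kernel: $\mathbb{K}(t)=0$ for $t<0$, and $\mathbb{K}(\tau)^T=\mathbb{K}(\tau)$, $\mathbb{K}(\tau)\ge 0$ for $\tau\ge0$; also $\mathbb{C}^T=\mathbb{C}$, $\mathbb{C}\ge 0$. The space $M$ of local strains is $E$ with inner product $\xi\cdot\eta\mapsto\mathbb{C}\xi\cdot\eta$; the space $N$ of local stresses is $F$ with inner product $\mathbb{C}^{-1}\sigma\cdot\tau$. The operator norm of $\mathbb{K}(\tau)$ is taken as a map from $M$ to $N$ (equivalently, of $\mathbb{C}^{-1}\mathbb{K}(\tau)$ on $M$). Given the weight $w$, define the measure $d\mu(t)=w(T-t)\,dt$ on $(-\infty,T)$. Set $\mathcal{M}=L^2((-\infty,T),M,\mu)$ with inner product $(\xi,\eta)=\int_{-\infty}^T\mathbb{C}\xi(t)\cdot\eta(t)\,d\mu(t)$, and $\mathcal{N}=L^2((-\infty,T),N,\mu)$ with norm $\|\sigma\|^2=\int_{-\infty}^T\mathbb{C}^{-1}\sigma(t)\cdot\sigma(t)\,d\mu(t)$. The plastic-strain operator is $P\epsilon(t)=\int_{-\infty}^t\mathbb{C}^{-1}\mathbb{K}(t-s)\epsilon(s)\,ds$, and the bilinear form is $a(\xi,\eta)=(\xi,\eta)-(P\xi,\eta)$ for $\xi,\eta\in\mathcal{M}$ (this is the variational form of the hereditary law $\sigma(t)=\mathbb{C}\epsilon(t)-\int_{-\infty}^t\mathbb{K}(t-s)\epsilon(s)\,ds$). *)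

theory Defs
  imports "HOL-Analysis.Analysis"
begin

text \<open>E = symmetric 3x3 real matrices; F = E^* identified with symmetric matrices
  via the Frobenius pairing (the inner product on real^3^3).\<close>

definition Sym3 :: "(real^3^3) set" where
  "Sym3 = {A. transpose A = A}"

definition Cinv :: "(real^3^3 \<Rightarrow> real^3^3) \<Rightarrow> real^3^3 \<Rightarrow> real^3^3" where
  "Cinv C \<sigma> = (THE \<xi>. \<xi> \<in> Sym3 \<and> C \<xi> = \<sigma>)"

definition opnormMN :: "(real^3^3 \<Rightarrow> real^3^3) \<Rightarrow> (real^3^3 \<Rightarrow> real^3^3) \<Rightarrow> real" where
  "opnormMN C k = Sup {sqrt (Cinv C (k \<xi>) \<bullet> k \<xi>) | \<xi>. \<xi> \<in> Sym3 \<and> C \<xi> \<bullet> \<xi> \<le> 1}"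

definition mu :: "real \<Rightarrow> (real \<Rightarrow> real) \<Rightarrow> real measure" where
  "mu T w = density lborel (\<lambda>t. ennreal (indicator {..<T} t * w (T - t)))"

definition inM :: "(real^3^3 \<Rightarrow> real^3^3) \<Rightarrow> real \<Rightarrow> (real \<Rightarrow> real) \<Rightarrow> (real \<Rightarrow> real^3^3) \<Rightarrow> bool" where
  "inM C T w \<xi> \<longleftrightarrow> \<xi> \<in> borel_measurable lborel \<and> (\<forall>t. \<xi> t \<in> Sym3)
      \<and> integrable (mu T w) (\<lambda>t. C (\<xi> t) \<bullet> \<xi> t)"

definition inN :: "(real^3^3 \<Rightarrow> real^3^3) \<Rightarrow> real \<Rightarrow> (real \<Rightarrow> real) \<Rightarrow> (real \<Rightarrow> real^3^3) \<Rightarrow> bool" where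
  "inN C T w \<sigma> \<longleftrightarrow> \<sigma> \<in> borel_measurable lborel \<and> (\<forall>t. \<sigma> t \<in> Sym3)
      \<and> integrable (mu T w) (\<lambda>t. Cinv C (\<sigma> t) \<bullet> \<sigma> t)"

definition innerM :: "(real^3^3 \<Rightarrow> real^3^3) \<Rightarrow> real \<Rightarrow> (real \<Rightarrow> real) \<Rightarrow> (real \<Rightarrow> real^3^3) \<Rightarrow> (real \<Rightarrow> real^3^3) \<Rightarrow> real" where
  "innerM C T w \<xi> \<eta> = (\<integral>t. C (\<xi> t) \<bullet> \<eta> t \<partial>mu T w)"

definition normM :: "(real^3^3 \<Rightarrow> real^3^3) \<Rightarrow> real \<Rightarrow> (real \<Rightarrow> real) \<Rightarrow> (real \<Rightarrow> real^3^3) \<Rightarrow> real" where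
  "normM C T w \<xi> = sqrt (innerM C T w \<xi> \<xi>)"

definition normN :: "(real^3^3 \<Rightarrow> real^3^3) \<Rightarrow> real \<Rightarrow> (real \<Rightarrow> real) \<Rightarrow> (real \<Rightarrow> real^3^3) \<Rightarrow> real" where
  "normN C T w \<sigma> = sqrt (\<integral>t. Cinv C (\<sigma> t) \<bullet> \<sigma> t \<partial>mu T w)"

definition Pop :: "(real^3^3 \<Rightarrow> real^3^3) \<Rightarrow> (real \<Rightarrow> real^3^3 \<Rightarrow> real^3^3) \<Rightarrow> (real \<Rightarrow> real^3^3) \<Rightarrow> real \<Rightarrow> real^3^3" where
  "Pop C K \<epsilon> t = set_lebesgue_integral lborel {..t} (\<lambda>s. Cinv C (K (t - s) (\<epsilon> s)))"

definition aform :: "(real^3^3 \<Rightarrow> real^3^3) \<Rightarrow> (real \<Rightarrow> real^3^3 \<Rightarrow> real^3^3) \<Rightarrow> real \<Rightarrow> (real \<Rightarrow> real)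
    \<Rightarrow> (real \<Rightarrow> real^3^3) \<Rightarrow> (real \<Rightarrow> real^3^3) \<Rightarrow> real" where
  "aform C K T w \<xi> \<eta> = innerM C T w \<xi> \<eta> - innerM C T w (Pop C K \<xi>) \<eta>"

end

theory Submission
  imports Defs
begin

text \<open>Since \<open>w\<close> satisfies the semigroup inequality, Cauchy--Schwarz and Tonelli bound the Volterra
  operator \<open>P\<close> on \<open>M\<close> by \<open>\<integral> \<parallel>K\<parallel> / w \<le> \<gamma> < 1\<close>. The Neumann series \<open>\<Sum>\<^sub>n P\<^sup>n (C\<^sup>-\<^sup>1 \<sigma>)\<close> converges
  absolutely almost everywhere with a square-integrable majorant, which replaces completeness of
  \<open>M\<close>, and its sum solves \<open>\<epsilon> - P \<epsilon> = C\<^sup>-\<^sup>1 \<sigma>\<close>. Uniqueness and the a priori bound follow from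
  the coercivity \<open>a(\<xi>, \<xi>) \<ge> (1 - \<gamma>) \<parallel>\<xi>\<parallel>\<^sup>2\<close>.\<close>

section \<open>The energy norm\<close>

text \<open>The square of the operator bound, \<gamma>^2, has two sources. One factor \<gamma> comes
  from Cauchy-Schwarz against the mass of the kernel norm, using \<open>w \<le> 1\<close>. The other
  comes from Tonelli, where the weight \<open>w (T - t)\<close> at the outer time must become
  \<open>w (T - s)\<close> at the inner time. The inequality
  \<open>w (T - t) * w (t - s) \<le> w (T - s)\<close> does this at the price of dividing the kernel
  by \<open>w (t - s)\<close>, which is why the fading memory condition has that form.

  Integrals over the infinite past need not converge at every time, and a divergent Bochner integral
  is 0, so \<open>P\<close> is linear only almost everywhere. Estimates are therefore made for
  \<open>ennreal\<close> majorants, and integrability is read off afterwards. Vectors are measured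
  by \<open>sqrt (C x \<bullet> x)\<close>, because the constants of equivalence with the Euclidean
  norm would spoil the bound by \<gamma>.\<close>

lemma borel_measurable_linear:
  fixes D :: "'a::euclidean_space \<Rightarrow> 'b::real_normed_vector"
  assumes "linear D" "f \<in> borel_measurable M"
  shows "(\<lambda>x. D (f x)) \<in> borel_measurable M"
  using assms borel_measurable_continuous_onI[OF linear_continuous_on[of D UNIV]]
  by (auto simp: linear_conv_bounded_linear)

text \<open>\<open>V\<close> is a subspace of the ambient type because symmetric matrices live
  inside all matrices, and \<open>C\<close> is symmetric and positive only there. Off
  \<open>V\<close> the form may be negative, so membership in \<open>V\<close> recurs as a side
  condition.\<close>

locale strain_space =
  fixes V :: "'a::euclidean_space set" and C :: "'a \<Rightarrow> 'a"
  assumes subspace_V: "subspace V"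
    and linear_C: "linear C"
    and C_symmetric: "x \<in> V \<Longrightarrow> y \<in> V \<Longrightarrow> C x \<bullet> y = x \<bullet> C y"
    and C_positive: "x \<in> V \<Longrightarrow> x \<noteq> 0 \<Longrightarrow> 0 < C x \<bullet> x"
begin

definition energy_norm :: "'a \<Rightarrow> real" where
  "energy_norm x = sqrt (C x \<bullet> x)"

lemma form_nonneg: "x \<in> V \<Longrightarrow> 0 \<le> C x \<bullet> x"
  using C_positive[of x] by (cases "x = 0") auto

lemma energy_norm_nonneg: "x \<in> V \<Longrightarrow> 0 \<le> energy_norm x"
  by (simp add: energy_norm_def form_nonneg)

lemma energy_norm_square: "x \<in> V \<Longrightarrow> (energy_norm x)\<^sup>2 = C x \<bullet> x"
  by (simp add: energy_norm_def form_nonneg)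

lemma energy_norm_eq_0: "x \<in> V \<Longrightarrow> energy_norm x = 0 \<longleftrightarrow> x = 0"
  using C_positive[of x] by (force simp: energy_norm_def linear_0[OF linear_C])

lemma energy_norm_zero: "energy_norm 0 = 0"
  by (simp add: energy_norm_def)

lemma borel_measurable_C [measurable]: "C \<in> borel_measurable borel"
  by (intro borel_measurable_continuous_onI linear_continuous_on)
     (simp add: linear_C linear_conv_bounded_linear[symmetric])

lemma borel_measurable_energy_norm [measurable]: "energy_norm \<in> borel_measurable borel"
  unfolding energy_norm_def by measurable

lemma continuous_on_energy_norm: "continuous_on S energy_norm"
  unfolding energy_norm_def
  by (intro continuous_intros linear_continuous_on)
     (simp add: linear_C linear_conv_bounded_linear[symmetric])

lemma Cauchy_Schwarz_form:
  assumes x: "x \<in> V" and y: "y \<in> V"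
  shows "\<bar>C x \<bullet> y\<bar> \<le> energy_norm x * energy_norm y"
proof (cases "y = 0")
  case True
  then show ?thesis by (simp add: energy_norm_zero)
next
  case False
  define p q b where "p = C x \<bullet> x" and "q = C y \<bullet> y" and "b = C x \<bullet> y"
  have q: "q > 0"
    using C_positive[OF y False] by (simp add: q_def)
  have b': "C y \<bullet> x = b"
    using C_symmetric[OF y x] by (simp add: b_def inner_commute)
  \<comment> \<open>This vector is a multiple of the part of \<open>x\<close> that is
    \<open>C\<close>-orthogonal to \<open>y\<close>, scaled by \<open>q\<close> to avoid
    division.\<close>
  have "q *\<^sub>R x - b *\<^sub>R y \<in> V"
    using x y subspace_V by (simp add: subspace_diff subspace_scale)
  from form_nonneg[OF this] have "0 \<le> q * (p * q - b\<^sup>2)"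
    by (simp add: linear_diff[OF linear_C] linear_scale[OF linear_C] inner_diff b'
        flip: p_def q_def b_def) (simp add: algebra_simps power2_eq_square)
  then have "b\<^sup>2 \<le> p * q"
    using q by (simp add: zero_le_mult_iff)
  then have "sqrt (b\<^sup>2) \<le> sqrt (p * q)"
    by (rule real_sqrt_le_mono)
  then show ?thesis
    by (simp add: energy_norm_def real_sqrt_mult p_def q_def b_def)
qed

lemma energy_norm_triangle:
  assumes x: "x \<in> V" and y: "y \<in> V"
  shows "energy_norm (x + y) \<le> energy_norm x + energy_norm y"
proof (rule power2_le_imp_le)
  have "(energy_norm (x + y))\<^sup>2 = C x \<bullet> x + 2 * (C x \<bullet> y) + C y \<bullet> y"
    using x y C_symmetric[OF y x]
    by (simp add: energy_norm_square subspace_add[OF subspace_V] linear_add[OF linear_C]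
        inner_add inner_commute)
  also have "\<dots> \<le> (energy_norm x + energy_norm y)\<^sup>2"
    using Cauchy_Schwarz_form[OF x y] by (simp add: power2_sum energy_norm_square x y)
  finally show "(energy_norm (x + y))\<^sup>2 \<le> (energy_norm x + energy_norm y)\<^sup>2" .
qed (simp add: energy_norm_nonneg x y)

lemma energy_norm_scale: "energy_norm (r *\<^sub>R x) = \<bar>r\<bar> * energy_norm x"
  by (simp add: energy_norm_def linear_scale[OF linear_C] real_sqrt_mult flip: mult.assoc)

lemma energy_norm_sum_le:
  "(\<And>i. i \<in> I \<Longrightarrow> f i \<in> V) \<Longrightarrow> energy_norm (\<Sum>i\<in>I. f i) \<le> (\<Sum>i\<in>I. energy_norm (f i))"
proof (induction I rule: infinite_finite_induct)
  case (insert i I)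
  then have "energy_norm (f i + (\<Sum>i\<in>I. f i)) \<le> energy_norm (f i) + energy_norm (\<Sum>i\<in>I. f i)"
    by (intro energy_norm_triangle) (auto intro!: subspace_sum[OF subspace_V])
  then show ?case using insert by simp
qed (simp_all add: energy_norm_zero)

text \<open>The energy norm attains a positive minimum on the compact unit sphere of
  \<open>V\<close>, and \<open>c\<close> is its reciprocal; the sphere is empty if \<open>V\<close>
  is trivial. This turns energy bounds into absolute convergence and Bochner integrability.\<close>

lemma norm_le_energy_norm:
  obtains c where "c > 0" "\<And>x. x \<in> V \<Longrightarrow> norm x \<le> c * energy_norm x"
proof (cases "V \<inter> sphere 0 1 = {}")
  case True
  have "norm x \<le> 1 * energy_norm x" if "x \<in> V" for x
  proof (rule ccontr)
    assume "\<not> ?thesis"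
    then have "x \<noteq> 0" by (auto simp: energy_norm_zero)
    then have "(1 / norm x) *\<^sub>R x \<in> V \<inter> sphere 0 1"
      using that by (simp add: subspace_scale[OF subspace_V])
    with True show False by blast
  qed
  then show ?thesis using that[of 1] by simp
next
  case False
  have "compact (V \<inter> sphere 0 1)"
    by (simp add: closed_subspace[OF subspace_V] closed_Int_compact)
  then obtain x0 where x0: "x0 \<in> V" "norm x0 = 1"
    and min: "\<And>y. y \<in> V \<Longrightarrow> norm y = 1 \<Longrightarrow> energy_norm x0 \<le> energy_norm y"
    using continuous_attains_inf[OF _ False continuous_on_energy_norm] by auto
  have pos: "energy_norm x0 > 0"
    using x0 energy_norm_nonneg[of x0] energy_norm_eq_0[of x0] by force
  have "norm x \<le> 1 / energy_norm x0 * energy_norm x" if "x \<in> V" for x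
  proof (cases "x = 0")
    case True
    then show ?thesis by (simp add: energy_norm_zero)
  next
    case False
    then have "energy_norm x0 \<le> energy_norm ((1 / norm x) *\<^sub>R x)"
      using that by (intro min) (simp_all add: subspace_scale[OF subspace_V])
    then show ?thesis
      using pos False by (simp add: energy_norm_scale field_simps)
  qed
  then show ?thesis
    using pos that[of "1 / energy_norm x0"] by simp
qed

text \<open>Positivity makes \<open>C\<close> injective on \<open>V\<close>; if \<open>C\<close>
  also maps \<open>V\<close> into itself, a dimension count makes it onto. Being linear on the whole
  type, \<open>D\<close> is a measurable stand-in for the inverse of \<open>C\<close> on
  \<open>V\<close>.\<close>

lemma left_inverse:
  obtains D where "range D \<subseteq> V" "linear D" "\<And>x. x \<in> V \<Longrightarrow> D (C x) = x"
    "C ` V \<subseteq> V \<Longrightarrow> (\<And>x. x \<in> V \<Longrightarrow> C (D x) = x)"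
proof -
  have inj: "inj_on C V"
  proof (rule inj_onI)
    fix x y assume "x \<in> V" "y \<in> V" "C x = C y"
    then have "x - y \<in> V" "C (x - y) = 0"
      by (simp_all add: subspace_diff[OF subspace_V] linear_diff[OF linear_C])
    then show "x = y" using C_positive[of "x - y"] by force
  qed
  then obtain D where D: "range D \<subseteq> V" "linear D" "\<And>x. x \<in> V \<Longrightarrow> D (C x) = x"
    using linear_exists_left_inverse_on[OF linear_C subspace_V] by metis
  have "C (D x) = x" if CV: "C ` V \<subseteq> V" and x: "x \<in> V" for x
  proof -
    have "C ` V = V"
    proof (rule subspace_dim_equal)
      show "dim V \<le> dim (C ` V)"
        using inj by (simp add: dim_image_eq[OF linear_C] subspace_V span_eq_iff[THEN iffD2])
    qed (fact linear_subspace_image[OF linear_C subspace_V], fact subspace_V, fact CV)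
    then obtain y where "y \<in> V" "x = C y" using x by blast
    then show ?thesis using D(3)[of y] by simp
  qed
  with D show ?thesis by (rule that)
qed

text \<open>The map \<open>D\<close> after \<open>C\<close> is bounded linear, fixes
  \<open>V\<close> and has range in \<open>V\<close>, so it commutes with the integral and fixes its
  value. A divergent integral is 0, which also lies in \<open>V\<close>.\<close>

lemma integral_in_V:
  assumes "\<And>s. g s \<in> V"
  shows "(\<integral>s. g s \<partial>M) \<in> V"
proof (cases "integrable M g")
  case True
  obtain D where D: "range D \<subseteq> V" "linear D" "\<And>x. x \<in> V \<Longrightarrow> D (C x) = x"
    using left_inverse by metis
  have bl: "bounded_linear (\<lambda>x. D (C x))"
    using linear_compose[OF linear_C D(2)]
    by (simp add: o_def linear_conv_bounded_linear[symmetric])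
  have "D (C (\<integral>s. g s \<partial>M)) = (\<integral>s. g s \<partial>M)"
    by (simp add: D(3) assms flip: integral_bounded_linear[OF bl True])
  moreover have "D (C (\<integral>s. g s \<partial>M)) \<in> V"
    using D(1) by blast
  ultimately show ?thesis by simp
next
  case False
  then show ?thesis by (simp add: not_integrable_integral_eq subspace_0[OF subspace_V])
qed

text \<open>Duality: with \<open>z\<close> the integral, the square of its energy norm is the
  integral of \<open>C z \<bullet> g s\<close>, and Cauchy-Schwarz leaves one factor to cancel. If
  an integral diverges, the left side is 0 or the right side infinite.\<close>

lemma energy_norm_integral_le:
  assumes V: "\<And>s. g s \<in> V" and [measurable]: "g \<in> borel_measurable M"
  shows "ennreal (energy_norm (\<integral>s. g s \<partial>M)) \<le> (\<integral>\<^sup>+s. ennreal (energy_norm (g s)) \<partial>M)"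
proof (cases "integrable M g \<and> (\<integral>\<^sup>+s. ennreal (energy_norm (g s)) \<partial>M) < \<infinity>")
  case True
  define z where "z = (\<integral>s. g s \<partial>M)"
  have z: "z \<in> V" unfolding z_def using V by (rule integral_in_V)
  have int: "integrable M (\<lambda>s. energy_norm (g s))"
    using True V by (intro integrableI_nonneg) (auto simp: energy_norm_nonneg)
  have "energy_norm z * energy_norm z = C z \<bullet> z"
    using energy_norm_square[OF z] by (simp add: power2_eq_square)
  also have "\<dots> = (\<integral>s. C z \<bullet> g s \<partial>M)"
    using True by (simp add: z_def)
  also have "\<dots> \<le> (\<integral>s. energy_norm z * energy_norm (g s) \<partial>M)"
    using True int Cauchy_Schwarz_form[OF z V]
    by (intro integral_mono) (auto intro: order_trans[OF abs_ge_self])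
  also have "\<dots> = energy_norm z * (\<integral>s. energy_norm (g s) \<partial>M)"
    by simp
  finally have "energy_norm z \<le> (\<integral>s. energy_norm (g s) \<partial>M)"
    using energy_norm_nonneg[OF z] V
    by (cases "energy_norm z = 0") (auto intro!: Bochner_Integration.integral_nonneg energy_norm_nonneg)
  then show ?thesis
    using int V by (subst nn_integral_eq_integral) (auto simp: energy_norm_nonneg z_def ennreal_leI)
next
  case False
  then show ?thesis
    by (auto simp: not_integrable_integral_eq energy_norm_zero less_top[symmetric])
qed

end

section \<open>Convolution with a fading kernel\<close>

text \<open>Here \<open>k\<close> is meant as the operator norm of the kernel, \<open>h\<close> as
  that norm divided by the weight, and \<rho> as \<open>w (T - t)\<close> cut off at
  \<open>T\<close>. The semigroup inequality survives only as \<open>rho_k_le\<close>, and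
  \<open>w \<le> 1\<close> as \<open>k_le_h\<close>.\<close>

locale fading_kernel =
  fixes k h \<rho> :: "real \<Rightarrow> real" and T \<gamma> :: real
  assumes k_measurable [measurable]: "k \<in> borel_measurable borel"
    and h_measurable [measurable]: "h \<in> borel_measurable borel"
    and rho_measurable [measurable]: "\<rho> \<in> borel_measurable borel"
    and k_nonneg: "0 \<le> k \<tau>"
    and k_le_h: "k \<tau> \<le> h \<tau>"
    and k_causal: "\<tau> < 0 \<Longrightarrow> k \<tau> = 0"
    and rho_pos: "t < T \<Longrightarrow> 0 < \<rho> t"
    and rho_zero: "T \<le> t \<Longrightarrow> \<rho> t = 0"
    and rho_k_le: "\<rho> t * k (t - s) \<le> \<rho> s * h (t - s)"
    and h_bound: "(\<integral>\<^sup>+\<tau>. ennreal (h \<tau>) \<partial>lborel) \<le> ennreal \<gamma>"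
    and gamma_nonneg: "0 \<le> \<gamma>" and gamma_less: "\<gamma> < 1"
begin

definition history :: "real measure" where
  "history = density lborel (\<lambda>t. ennreal (\<rho> t))"

text \<open>With values in \<open>ennreal\<close> this majorant of \<open>P\<close> exists before
  anything is known to be integrable. Since \<open>k\<close> vanishes at negative arguments, only
  the past of \<open>t\<close> contributes.\<close>

definition conv :: "(real \<Rightarrow> ennreal) \<Rightarrow> real \<Rightarrow> ennreal" where
  "conv u t = (\<integral>\<^sup>+s. ennreal (k (t - s)) * u s \<partial>lborel)"

lemma h_nonneg: "0 \<le> h \<tau>"
  using k_nonneg k_le_h order_trans by blast

lemma rho_nonneg: "0 \<le> \<rho> t"
  using rho_pos[of t] rho_zero[of t] by (cases "t < T") auto

lemma sets_history [measurable_cong, simp]: "sets history = sets borel"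
  by (simp add: history_def)

lemma space_history [simp]: "space history = UNIV"
  by (simp add: history_def)

lemma AE_history_iff: "(AE t in history. Q t) \<longleftrightarrow> (AE t in lborel. t < T \<longrightarrow> Q t)"
proof -
  have "0 < ennreal (\<rho> t) \<longleftrightarrow> t < T" for t
    using rho_pos[of t] rho_zero[of t] by (cases "t < T") auto
  then show ?thesis
    unfolding history_def by (subst AE_density) simp_all
qed

lemma borel_measurable_conv [measurable]:
  assumes [measurable]: "u \<in> borel_measurable borel"
  shows "conv u \<in> borel_measurable borel"
  unfolding conv_def by measurable

text \<open>Cauchy-Schwarz after splitting \<open>k\<close> into two square roots: one half carries
  \<open>u\<close>, the other integrates to the mass of \<open>k\<close>, which is at most that of
  \<open>h\<close>.\<close>

lemma conv_square_le:
  assumes [measurable]: "u \<in> borel_measurable borel"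
  shows "(conv u t)\<^sup>2 \<le> ennreal \<gamma> * (\<integral>\<^sup>+s. ennreal (k (t - s)) * (u s)\<^sup>2 \<partial>lborel)"
proof -
  have sq: "ennreal (sqrt (k \<tau>)) * ennreal (sqrt (k \<tau>)) = ennreal (k \<tau>)" for \<tau>
    by (simp add: k_nonneg flip: ennreal_mult)
  have "(conv u t)\<^sup>2 = (\<integral>\<^sup>+s. ennreal (sqrt (k (t - s))) * (ennreal (sqrt (k (t - s))) * u s) \<partial>lborel)\<^sup>2"
    by (simp add: conv_def sq flip: mult.assoc)
  also have "\<dots> \<le> (\<integral>\<^sup>+s. (ennreal (sqrt (k (t - s))))\<^sup>2 \<partial>lborel) *
      (\<integral>\<^sup>+s. (ennreal (sqrt (k (t - s))) * u s)\<^sup>2 \<partial>lborel)"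
    by (rule Cauchy_Schwarz_nn_integral) measurable
  also have "\<dots> = (\<integral>\<^sup>+s. ennreal (k (t - s)) \<partial>lborel) *
      (\<integral>\<^sup>+s. ennreal (k (t - s)) * (u s)\<^sup>2 \<partial>lborel)"
    by (simp add: power_mult_distrib) (simp add: power2_eq_square sq)
  also have "(\<integral>\<^sup>+s. ennreal (k (t - s)) \<partial>lborel) = (\<integral>\<^sup>+\<tau>. ennreal (k \<tau>) \<partial>lborel)"
    using nn_integral_real_affine[of "\<lambda>s. ennreal (k s)" "- 1" t] by simp
  also have "\<dots> \<le> ennreal \<gamma>"
    by (rule order_trans[OF nn_integral_mono h_bound]) (simp add: k_le_h ennreal_leI)
  finally show ?thesis
    by (simp add: mult_right_mono)
qed

text \<open>The semigroup inequality moves the weight from \<^term>\<open>t\<close> to \<^term>\<open>s\<close> at the price of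
  replacing \<^term>\<open>k\<close> by \<^term>\<open>h\<close>, after which Tonelli's theorem applies.\<close>

lemma conv_contraction:
  assumes [measurable]: "u \<in> borel_measurable borel"
  shows "(\<integral>\<^sup>+t. (conv u t)\<^sup>2 \<partial>history) \<le> (ennreal \<gamma>)\<^sup>2 * (\<integral>\<^sup>+t. (u t)\<^sup>2 \<partial>history)"
proof -
  have "(\<integral>\<^sup>+t. (conv u t)\<^sup>2 \<partial>history)
      \<le> (\<integral>\<^sup>+t. ennreal \<gamma> * (\<integral>\<^sup>+s. ennreal (k (t - s)) * (u s)\<^sup>2 \<partial>lborel) \<partial>history)"
    by (intro nn_integral_mono conv_square_le assms)
  also have "\<dots> = ennreal \<gamma> *
      (\<integral>\<^sup>+t. (\<integral>\<^sup>+s. ennreal (\<rho> t) * (ennreal (k (t - s)) * (u s)\<^sup>2) \<partial>lborel) \<partial>lborel)"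
    unfolding history_def
    by (simp add: nn_integral_cmult nn_integral_density)
  also have "(\<integral>\<^sup>+t. (\<integral>\<^sup>+s. ennreal (\<rho> t) * (ennreal (k (t - s)) * (u s)\<^sup>2) \<partial>lborel) \<partial>lborel)
      \<le> (\<integral>\<^sup>+t. (\<integral>\<^sup>+s. ennreal (\<rho> s) * (u s)\<^sup>2 * ennreal (h (t - s)) \<partial>lborel) \<partial>lborel)"
  proof (intro nn_integral_mono)
    fix t s
    have "ennreal (\<rho> t) * ennreal (k (t - s)) \<le> ennreal (\<rho> s) * ennreal (h (t - s))"
      using rho_k_le[of t s] by (simp add: rho_nonneg k_nonneg h_nonneg ennreal_leI flip: ennreal_mult)
    from mult_right_mono[OF this, of "(u s)\<^sup>2"]
    show "ennreal (\<rho> t) * (ennreal (k (t - s)) * (u s)\<^sup>2) \<le> ennreal (\<rho> s) * (u s)\<^sup>2 * ennreal (h (t - s))"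
      by (simp add: mult_ac)
  qed
  \<comment> \<open>With \<open>s\<close> outside, the inner integral is the total mass of
    \<open>h\<close>. This is the second factor \<gamma>; the first came from
    \<open>conv_square_le\<close>.\<close>
  also have "\<dots> = (\<integral>\<^sup>+s. (\<integral>\<^sup>+t. ennreal (\<rho> s) * (u s)\<^sup>2 * ennreal (h (t - s)) \<partial>lborel) \<partial>lborel)"
    by (rule lborel_pair.Fubini') measurable
  also have "\<dots> = (\<integral>\<^sup>+s. ennreal (\<rho> s) * (u s)\<^sup>2 * (\<integral>\<^sup>+t. ennreal (h (t - s)) \<partial>lborel) \<partial>lborel)"
    by (simp add: nn_integral_cmult)
  also have "\<dots> \<le> (\<integral>\<^sup>+s. ennreal (\<rho> s) * (u s)\<^sup>2 * ennreal \<gamma> \<partial>lborel)"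
  proof (intro nn_integral_mono mult_left_mono)
    fix s
    show "(\<integral>\<^sup>+t. ennreal (h (t - s)) \<partial>lborel) \<le> ennreal \<gamma>"
      using nn_integral_real_affine[of "\<lambda>s. ennreal (h s)" 1 "- s"] h_bound by simp
  qed simp
  also have "\<dots> = ennreal \<gamma> * (\<integral>\<^sup>+t. (u t)\<^sup>2 \<partial>history)"
    unfolding history_def by (simp add: nn_integral_density nn_integral_multc mult.commute[of "ennreal \<gamma>"])
  finally show ?thesis
    by (simp add: mult_left_mono power2_eq_square mult.assoc)
qed

text \<open>A square-integrable function is finite almost everywhere; this is what makes the
  hereditary integral converge at almost every time.\<close>

lemma AE_conv_finite:
  assumes [measurable]: "u \<in> borel_measurable borel"
    and "(\<integral>\<^sup>+t. (u t)\<^sup>2 \<partial>history) < \<infinity>"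
  shows "AE t in history. conv u t < \<infinity>"
proof -
  have "(\<integral>\<^sup>+t. (conv u t)\<^sup>2 \<partial>history) < \<infinity>"
    using assms(2)
    by (auto intro!: le_less_trans[OF conv_contraction] simp: ennreal_mult_less_top power_less_top_ennreal)
  then have "AE t in history. (conv u t)\<^sup>2 \<noteq> \<infinity>"
    by (intro nn_integral_PInf_AE) auto
  then show ?thesis
    by eventually_elim (auto simp: power_less_top_ennreal less_top[symmetric] power_eq_top_ennreal)
qed

text \<open>Minkowski's inequality for geometrically decaying summands: Cauchy--Schwarz against the
  weights \<open>r ^ n\<close> with \<open>\<gamma> < r < 1\<close>.\<close>

lemma nn_integral_suminf_square_finite:
  fixes u :: "nat \<Rightarrow> real \<Rightarrow> ennreal"
  assumes [measurable]: "\<And>n. u n \<in> borel_measurable borel"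
    and B: "B < \<infinity>"
    and u: "\<And>n. (\<integral>\<^sup>+t. (u n t)\<^sup>2 \<partial>history) \<le> (ennreal \<gamma>) ^ (2 * n) * B"
  shows "(\<integral>\<^sup>+t. (\<Sum>n. u n t)\<^sup>2 \<partial>history) < \<infinity>"
proof -
  define r where "r = (1 + \<gamma>) / 2"
  have r: "0 < r" "\<gamma> < r" "r < 1"
    using gamma_nonneg gamma_less by (auto simp: r_def)
  have inv: "ennreal (r ^ n) * ennreal (1 / r ^ n) = 1" for n
    using r by (simp flip: ennreal_mult)
  have geo: "(\<Sum>n. ennreal (x ^ n)) < \<infinity>" if "0 \<le> x" "x < 1" for x :: real
    using that by (subst suminf_ennreal_eq[where x = "1 / (1 - x)"]) (auto intro: geometric_sums)
  have CS: "(\<Sum>n. u n t)\<^sup>2 \<le> (\<Sum>n. ennreal ((r\<^sup>2) ^ n)) * (\<Sum>n. ennreal (1 / (r\<^sup>2) ^ n) * (u n t)\<^sup>2)" for t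
  proof -
    have "(\<Sum>n. u n t)\<^sup>2
        = (\<integral>\<^sup>+n. ennreal (r ^ n) * (ennreal (1 / r ^ n) * u n t) \<partial>count_space UNIV)\<^sup>2"
      by (simp add: nn_integral_count_space_nat inv flip: mult.assoc)
    also have "\<dots> \<le> (\<integral>\<^sup>+n. (ennreal (r ^ n))\<^sup>2 \<partial>count_space UNIV) *
        (\<integral>\<^sup>+n. (ennreal (1 / r ^ n) * u n t)\<^sup>2 \<partial>count_space UNIV)"
      by (rule Cauchy_Schwarz_nn_integral) auto
    also have "\<dots> = (\<Sum>n. ennreal ((r\<^sup>2) ^ n)) * (\<Sum>n. ennreal (1 / (r\<^sup>2) ^ n) * (u n t)\<^sup>2)"
      using r by (simp add: nn_integral_count_space_nat power_mult_distrib ennreal_power power_divide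
          power_mult[symmetric] mult.commute)
    finally show ?thesis .
  qed
  have "(\<integral>\<^sup>+t. (\<Sum>n. u n t)\<^sup>2 \<partial>history)
      \<le> (\<integral>\<^sup>+t. (\<Sum>n. ennreal ((r\<^sup>2) ^ n)) * (\<Sum>n. ennreal (1 / (r\<^sup>2) ^ n) * (u n t)\<^sup>2) \<partial>history)"
    by (intro nn_integral_mono CS)
  also have "\<dots> = (\<Sum>n. ennreal ((r\<^sup>2) ^ n)) *
      (\<Sum>n. ennreal (1 / (r\<^sup>2) ^ n) * (\<integral>\<^sup>+t. (u n t)\<^sup>2 \<partial>history))"
    by (simp add: nn_integral_cmult nn_integral_suminf)
  \<comment> \<open>The choice \<open>r < 1\<close> makes the first series converge, and
    \<open>\<gamma> < r\<close> makes the second one geometric with ratio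
    \<open>(\<gamma> / r)^2 < 1\<close>.\<close>
  also have "\<dots> \<le> (\<Sum>n. ennreal ((r\<^sup>2) ^ n)) * (\<Sum>n. ennreal (((\<gamma> / r)\<^sup>2) ^ n) * B)"
  proof (intro mult_left_mono suminf_le)
    fix n
    have "ennreal (1 / (r\<^sup>2) ^ n) * (\<integral>\<^sup>+t. (u n t)\<^sup>2 \<partial>history)
        \<le> ennreal (1 / (r\<^sup>2) ^ n) * ((ennreal \<gamma>) ^ (2 * n) * B)"
      by (intro mult_left_mono u) simp
    also have "\<dots> = ennreal (((\<gamma> / r)\<^sup>2) ^ n) * B"
      using r gamma_nonneg
      by (simp add: ennreal_power power_divide power_mult flip: mult.assoc ennreal_mult)
    finally show "ennreal (1 / (r\<^sup>2) ^ n) * (\<integral>\<^sup>+t. (u n t)\<^sup>2 \<partial>history)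
        \<le> ennreal (((\<gamma> / r)\<^sup>2) ^ n) * B" .
  qed auto
  also have "\<dots> = (\<Sum>n. ennreal ((r\<^sup>2) ^ n)) * ((\<Sum>n. ennreal (((\<gamma> / r)\<^sup>2) ^ n)) * B)"
    by (simp add: ennreal_suminf_multc)
  also have "\<dots> < \<infinity>"
  proof -
    have "r\<^sup>2 < 1" "(\<gamma> / r)\<^sup>2 < 1"
      unfolding abs_square_less_1 using r gamma_nonneg by simp_all
    then have "(\<Sum>n. ennreal ((r\<^sup>2) ^ n)) < \<infinity>" "(\<Sum>n. ennreal (((\<gamma> / r)\<^sup>2) ^ n)) < \<infinity>"
      by (simp_all only: geo zero_le_power2)
    then show ?thesis
      using B by (simp only: infinity_ennreal_def ennreal_mult_less_top) blast
  qed
  finally show ?thesis .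
qed

end

section \<open>The hereditary law\<close>

text \<open>\<open>L\<close> plays the role of \<open>C^-1 K\<close>. Causality is contained in
  \<open>L_bound\<close>, as \<open>k\<close> vanishes at negative times.\<close>

locale hereditary_law = strain_space V C + fading_kernel k h \<rho> T \<gamma>
  for V :: "'a::euclidean_space set" and C k h \<rho> T \<gamma> +
  fixes L :: "real \<Rightarrow> 'a \<Rightarrow> 'a"
  assumes linear_L: "linear (L \<tau>)"
    and L_in_V: "x \<in> V \<Longrightarrow> L \<tau> x \<in> V"
    and L_measurable: "(\<lambda>\<tau>. L \<tau> x) \<in> borel_measurable borel"
    and L_bound: "x \<in> V \<Longrightarrow> energy_norm (L \<tau> x) \<le> k \<tau> * energy_norm x"
begin

definition strain :: "(real \<Rightarrow> 'a) \<Rightarrow> bool" where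
  "strain f \<longleftrightarrow> f \<in> borel_measurable borel \<and> (\<forall>t. f t \<in> V)"

text \<open>The squared norm of \<open>M\<close>, valued in \<open>ennreal\<close> so that
  \<open>energy f < \<infinity>\<close> expresses membership in \<open>M\<close> for a
  strain.\<close>

definition energy :: "(real \<Rightarrow> 'a) \<Rightarrow> ennreal" where
  "energy f = (\<integral>\<^sup>+t. (ennreal (energy_norm (f t)))\<^sup>2 \<partial>history)"

text \<open>The integral runs over all of \<open>lborel\<close> because \<open>L\<close> vanishes on
  \<open>V\<close> at negative times. Where it diverges its value is 0, so \<open>plastic f\<close>
  is a strain for every strain \<open>f\<close>.\<close>

definition plastic :: "(real \<Rightarrow> 'a) \<Rightarrow> real \<Rightarrow> 'a" where
  "plastic f t = (\<integral>s. L (t - s) (f s) \<partial>lborel)"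

lemma strainD:
  assumes "strain f"
  shows "f \<in> borel_measurable borel" "f t \<in> V"
  using assms by (auto simp: strain_def)

text \<open>Joint measurability from measurability in time alone: expanding the vector in a basis
  writes the value as a finite sum of coordinates times measurable functions of time.\<close>

lemma borel_measurable_L [measurable (raw)]:
  assumes [measurable]: "g \<in> borel_measurable M" "f \<in> borel_measurable M"
  shows "(\<lambda>x. L (g x) (f x)) \<in> borel_measurable M"
proof -
  have "L \<tau> x = (\<Sum>b\<in>Basis. (x \<bullet> b) *\<^sub>R L \<tau> b)" for \<tau> x
    by (subst (1) euclidean_representation[symmetric, of x])
       (simp add: linear_sum[OF linear_L] linear_scale[OF linear_L])
  then have "(\<lambda>x. L (g x) (f x)) = (\<lambda>x. \<Sum>b\<in>Basis. (f x \<bullet> b) *\<^sub>R L (g x) b)"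
    by (intro ext)
  moreover have [measurable]: "(\<lambda>x. L (g x) b) \<in> borel_measurable M" for b
    using measurable_compose[OF assms(1) L_measurable] .
  have "(\<lambda>x. \<Sum>b\<in>Basis. (f x \<bullet> b) *\<^sub>R L (g x) b) \<in> borel_measurable M"
    by measurable
  ultimately show ?thesis by (simp only:)
qed

lemma strain_plastic:
  assumes "strain f"
  shows "strain (plastic f)"
proof -
  note [measurable] = strainD(1)[OF assms]
  show ?thesis
    using strainD(2)[OF assms] unfolding strain_def plastic_def[abs_def]
    by (auto intro!: integral_in_V L_in_V)
qed

lemma strain_diff: "strain f \<Longrightarrow> strain g \<Longrightarrow> strain (\<lambda>t. f t - g t)"
  by (auto simp: strain_def subspace_diff[OF subspace_V])

lemma ennreal_L_bound:
  "x \<in> V \<Longrightarrow> ennreal (energy_norm (L \<tau> x)) \<le> ennreal (k \<tau>) * ennreal (energy_norm x)"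
  using L_bound[of x \<tau>] by (simp add: ennreal_leI k_nonneg energy_norm_nonneg flip: ennreal_mult)

lemma energy_norm_plastic_le:
  assumes "strain f"
  shows "ennreal (energy_norm (plastic f t)) \<le> conv (\<lambda>s. ennreal (energy_norm (f s))) t"
proof -
  note [measurable] = strainD(1)[OF assms]
  have "ennreal (energy_norm (plastic f t)) \<le> (\<integral>\<^sup>+s. ennreal (energy_norm (L (t - s) (f s))) \<partial>lborel)"
    unfolding plastic_def using strainD(2)[OF assms]
    by (intro energy_norm_integral_le L_in_V) auto
  also have "\<dots> \<le> conv (\<lambda>s. ennreal (energy_norm (f s))) t"
    unfolding conv_def using strainD(2)[OF assms] by (intro nn_integral_mono ennreal_L_bound)
  finally show ?thesis .
qed

lemma energy_plastic_le:
  assumes "strain f"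
  shows "energy (plastic f) \<le> (ennreal \<gamma>)\<^sup>2 * energy f"
proof -
  note [measurable] = strainD(1)[OF assms]
  have "energy (plastic f) \<le> (\<integral>\<^sup>+t. (conv (\<lambda>s. ennreal (energy_norm (f s))) t)\<^sup>2 \<partial>history)"
    unfolding energy_def using energy_norm_plastic_le[OF assms]
    by (intro nn_integral_mono power_mono) auto
  also have "\<dots> \<le> (ennreal \<gamma>)\<^sup>2 * energy f"
    unfolding energy_def by (rule conv_contraction) measurable
  finally show ?thesis .
qed

lemma energy_plastic_finite: "strain f \<Longrightarrow> energy f < \<infinity> \<Longrightarrow> energy (plastic f) < \<infinity>"
  by (rule le_less_trans[OF energy_plastic_le]) (auto simp: ennreal_mult_less_top power_less_top_ennreal)

text \<open>The constant is uniform in the history and in \<open>t\<close>, so that in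
  \<open>plastic_sums\<close> it can be taken out of a sum over infinitely many histories.\<close>

lemma nn_integral_norm_L_le:
  obtains c where "c > 0" "\<And>f t. strain f \<Longrightarrow>
    (\<integral>\<^sup>+s. ennreal (norm (L (t - s) (f s))) \<partial>lborel) \<le> ennreal c * conv (\<lambda>s. ennreal (energy_norm (f s))) t"
proof -
  obtain c where c: "c > 0" "\<And>x. x \<in> V \<Longrightarrow> norm x \<le> c * energy_norm x"
    using norm_le_energy_norm by metis
  have "(\<integral>\<^sup>+s. ennreal (norm (L (t - s) (f s))) \<partial>lborel)
      \<le> ennreal c * conv (\<lambda>s. ennreal (energy_norm (f s))) t" if f: "strain f" for f t
  proof -
    note [measurable] = strainD(1)[OF f]
    have "(\<integral>\<^sup>+s. ennreal (norm (L (t - s) (f s))) \<partial>lborel)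
        \<le> (\<integral>\<^sup>+s. ennreal c * (ennreal (k (t - s)) * ennreal (energy_norm (f s))) \<partial>lborel)"
    proof (rule nn_integral_mono)
      fix s
      have "ennreal (norm (L (t - s) (f s))) \<le> ennreal (c * energy_norm (L (t - s) (f s)))"
        by (intro ennreal_leI c(2) L_in_V strainD(2)[OF f])
      also have "\<dots> = ennreal c * ennreal (energy_norm (L (t - s) (f s)))"
        using c(1) by (intro ennreal_mult energy_norm_nonneg L_in_V strainD(2)[OF f]) auto
      also have "\<dots> \<le> ennreal c * (ennreal (k (t - s)) * ennreal (energy_norm (f s)))"
        by (intro mult_left_mono ennreal_L_bound strainD(2)[OF f]) simp
      finally show "ennreal (norm (L (t - s) (f s)))
          \<le> ennreal c * (ennreal (k (t - s)) * ennreal (energy_norm (f s)))" .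
    qed
    also have "\<dots> = ennreal c * conv (\<lambda>s. ennreal (energy_norm (f s))) t"
      unfolding conv_def by (rule nn_integral_cmult) measurable
    finally show ?thesis .
  qed
  with c(1) show ?thesis by (rule that)
qed

lemma integrable_L:
  assumes f: "strain f" and fin: "conv (\<lambda>s. ennreal (energy_norm (f s))) t < \<infinity>"
  shows "integrable lborel (\<lambda>s. L (t - s) (f s))"
proof (rule integrableI_bounded)
  obtain c where c: "\<And>f t. strain f \<Longrightarrow>
    (\<integral>\<^sup>+s. ennreal (norm (L (t - s) (f s))) \<partial>lborel) \<le> ennreal c * conv (\<lambda>s. ennreal (energy_norm (f s))) t"
    using nn_integral_norm_L_le by metis
  show "(\<integral>\<^sup>+s. ennreal (norm (L (t - s) (f s))) \<partial>lborel) < \<infinity>"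
    by (rule le_less_trans[OF c[OF f]]) (use fin in \<open>simp add: ennreal_mult_less_top\<close>)
  note [measurable] = strainD(1)[OF f]
  show "(\<lambda>s. L (t - s) (f s)) \<in> borel_measurable lborel"
    by measurable
qed

lemma AE_integrable_L:
  assumes f: "strain f" and fin: "energy f < \<infinity>"
  shows "AE t in history. integrable lborel (\<lambda>s. L (t - s) (f s))"
proof -
  have "AE t in history. conv (\<lambda>s. ennreal (energy_norm (f s))) t < \<infinity>"
    using strainD(1)[OF f] fin by (intro AE_conv_finite) (auto simp: energy_def)
  then show ?thesis
    by eventually_elim (rule integrable_L[OF f])
qed

text \<open>Linearity needs both integrals to converge, which finite energy guarantees only for
  almost every \<open>t\<close>.\<close>

lemma AE_plastic_diff:
  assumes "strain f" "energy f < \<infinity>" "strain g" "energy g < \<infinity>"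
  shows "AE t in history. plastic (\<lambda>s. f s - g s) t = plastic f t - plastic g t"
  using AE_integrable_L[OF assms(1,2)] AE_integrable_L[OF assms(3,4)]
proof eventually_elim
  case (elim t)
  show ?case
    unfolding plastic_def linear_diff[OF linear_L]
    by (rule Bochner_Integration.integral_diff[OF elim])
qed

section \<open>Inner product and norm on strain histories\<close>

lemma square_ennreal_energy_norm:
  "x \<in> V \<Longrightarrow> (ennreal (energy_norm x))\<^sup>2 = ennreal (C x \<bullet> x)"
  by (simp add: ennreal_power energy_norm_nonneg energy_norm_square)

lemma energy_finite_iff:
  assumes "strain f"
  shows "energy f < \<infinity> \<longleftrightarrow> integrable history (\<lambda>t. C (f t) \<bullet> f t)"
proof -
  note [measurable] = strainD(1)[OF assms]
  have "energy f = (\<integral>\<^sup>+t. ennreal (norm (C (f t) \<bullet> f t)) \<partial>history)"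
    unfolding energy_def
    by (simp add: square_ennreal_energy_norm[OF strainD(2)[OF assms]] form_nonneg[OF strainD(2)[OF assms]])
  then show ?thesis
    by (simp add: integrable_iff_bounded)
qed

lemma energy_eq_integral:
  assumes "strain f" "energy f < \<infinity>"
  shows "energy f = ennreal (\<integral>t. C (f t) \<bullet> f t \<partial>history)"
proof -
  have "integrable history (\<lambda>t. C (f t) \<bullet> f t)"
    using assms energy_finite_iff by blast
  then show ?thesis
    unfolding energy_def square_ennreal_energy_norm[OF strainD(2)[OF assms(1)]]
    by (rule nn_integral_eq_integral) (simp add: form_nonneg[OF strainD(2)[OF assms(1)]])
qed

definition strain_inner :: "(real \<Rightarrow> 'a) \<Rightarrow> (real \<Rightarrow> 'a) \<Rightarrow> real" where
  "strain_inner f g = (\<integral>t. C (f t) \<bullet> g t \<partial>history)"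

definition strain_norm :: "(real \<Rightarrow> 'a) \<Rightarrow> real" where
  "strain_norm f = sqrt (strain_inner f f)"

lemma strain_inner_self_nonneg: "strain f \<Longrightarrow> 0 \<le> strain_inner f f"
  unfolding strain_inner_def by (intro Bochner_Integration.integral_nonneg form_nonneg strainD(2))

lemma strain_norm_nonneg: "strain f \<Longrightarrow> 0 \<le> strain_norm f"
  by (simp add: strain_norm_def strain_inner_self_nonneg)

lemma strain_norm_square: "strain f \<Longrightarrow> (strain_norm f)\<^sup>2 = strain_inner f f"
  by (simp add: strain_norm_def strain_inner_self_nonneg)

lemma energy_eq_strain_norm:
  assumes "strain f" "energy f < \<infinity>"
  shows "energy f = ennreal ((strain_norm f)\<^sup>2)"
  unfolding strain_norm_square[OF assms(1)] strain_inner_def by (rule energy_eq_integral[OF assms])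

text \<open>A single \<open>ennreal\<close> estimate of \<open>J\<close>, the integral of the
  absolute value, yields both claims: its finiteness gives integrability, and the same estimate read
  in the reals gives the inequality.\<close>

lemma strain_inner_Cauchy_Schwarz:
  assumes f: "strain f" "energy f < \<infinity>" and g: "strain g" "energy g < \<infinity>"
  shows "integrable history (\<lambda>t. C (f t) \<bullet> g t)"
    and "\<bar>strain_inner f g\<bar> \<le> strain_norm f * strain_norm g"
proof -
  note [measurable] = strainD(1)[OF f(1)] strainD(1)[OF g(1)]
  define J where "J = (\<integral>\<^sup>+t. ennreal (norm (C (f t) \<bullet> g t)) \<partial>history)"
  have "J \<le> (\<integral>\<^sup>+t. ennreal (energy_norm (f t)) * ennreal (energy_norm (g t)) \<partial>history)"
    unfolding J_def using Cauchy_Schwarz_form strainD(2)[OF f(1)] strainD(2)[OF g(1)]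
    by (intro nn_integral_mono) (simp add: ennreal_leI energy_norm_nonneg flip: ennreal_mult)
  then have "J\<^sup>2 \<le> (\<integral>\<^sup>+t. ennreal (energy_norm (f t)) * ennreal (energy_norm (g t)) \<partial>history)\<^sup>2"
    by (intro power_mono) auto
  also have "\<dots> \<le> energy f * energy g"
    unfolding energy_def by (rule Cauchy_Schwarz_nn_integral) measurable
  also have "\<dots> = ennreal ((strain_norm f * strain_norm g)\<^sup>2)"
    unfolding energy_eq_strain_norm[OF f] energy_eq_strain_norm[OF g]
    by (simp add: power_mult_distrib flip: ennreal_mult)
  finally have J2: "J\<^sup>2 \<le> ennreal ((strain_norm f * strain_norm g)\<^sup>2)" .
  have "J\<^sup>2 < \<infinity>"
    using J2 by (rule le_less_trans) simp
  then have "J < \<infinity>"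
    by (simp add: power_less_top_ennreal)
  then show int: "integrable history (\<lambda>t. C (f t) \<bullet> g t)"
    unfolding J_def by (intro integrableI_bounded) auto
  define j where "j = (\<integral>t. norm (C (f t) \<bullet> g t) \<partial>history)"
  have j: "J = ennreal j" "j \<ge> 0"
    unfolding J_def j_def using int by (auto intro!: nn_integral_eq_integral)
  have "j\<^sup>2 \<le> (strain_norm f * strain_norm g)\<^sup>2"
    using J2 j by (simp add: ennreal_power)
  then have "j \<le> strain_norm f * strain_norm g"
    by (rule power2_le_imp_le) (simp add: strain_norm_nonneg f g)
  moreover have "\<bar>strain_inner f g\<bar> \<le> j"
    unfolding strain_inner_def j_def real_norm_def[symmetric] by (rule integral_norm_bound)
  ultimately show "\<bar>strain_inner f g\<bar> \<le> strain_norm f * strain_norm g" by linarith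
qed

lemma strain_norm_plastic_le:
  assumes "strain f" "energy f < \<infinity>"
  shows "strain_norm (plastic f) \<le> \<gamma> * strain_norm f"
proof (rule power2_le_imp_le)
  have "ennreal ((strain_norm (plastic f))\<^sup>2) \<le> ennreal (\<gamma>\<^sup>2 * (strain_norm f)\<^sup>2)"
    using energy_plastic_le[OF assms(1)] gamma_nonneg
    unfolding energy_eq_strain_norm[OF assms]
      energy_eq_strain_norm[OF strain_plastic[OF assms(1)] energy_plastic_finite[OF assms]]
    by (simp add: ennreal_power flip: ennreal_mult)
  then show "(strain_norm (plastic f))\<^sup>2 \<le> (\<gamma> * strain_norm f)\<^sup>2"
    by (simp add: power_mult_distrib)
qed (simp add: gamma_nonneg strain_norm_nonneg assms)

text \<open>Subtracted from the squared norm of \<open>f\<close>, this is the coercivity of the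
  bilinear form with constant \<open>1 - \<gamma>\<close>.\<close>

lemma plastic_inner_le:
  assumes "strain f" "energy f < \<infinity>"
  shows "strain_inner (plastic f) f \<le> \<gamma> * (strain_norm f)\<^sup>2"
proof -
  have "strain_inner (plastic f) f \<le> strain_norm (plastic f) * strain_norm f"
    using strain_inner_Cauchy_Schwarz(2)[OF strain_plastic[OF assms(1)] energy_plastic_finite[OF assms] assms]
    by linarith
  also have "\<dots> \<le> (\<gamma> * strain_norm f) * strain_norm f"
    by (intro mult_right_mono strain_norm_plastic_le strain_norm_nonneg assms)
  finally show ?thesis by (simp add: power2_eq_square mult.assoc)
qed

section \<open>Neumann series for the fixed point equation\<close>

lemma L_causal: "\<tau> < 0 \<Longrightarrow> x \<in> V \<Longrightarrow> L \<tau> x = 0"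
  using L_bound[of x \<tau>] energy_norm_nonneg[OF L_in_V, of x \<tau>] energy_norm_eq_0[OF L_in_V, of x \<tau>]
  by (simp add: k_causal)

text \<open>Dominated exchange of series and integral at one fixed time. Finiteness of
  \<open>conv\<close> on the sum of the energy norms makes the integrals of the norms summable, and
  continuity of each \<open>L \<tau>\<close> identifies the limit.\<close>

lemma plastic_sums:
  assumes f: "\<And>n. strain (f n)"
    and "t < T"
    and fin: "conv (\<lambda>s. \<Sum>n. ennreal (energy_norm (f n s))) t < \<infinity>"
    and sums: "AE s in history. summable (\<lambda>n. norm (f n s)) \<and> (\<lambda>n. f n s) sums g s"
    and g: "strain g"
  shows "(\<lambda>n. plastic (f n) t) sums plastic g t"
proof -
  note [measurable] = strainD(1)[OF f] strainD(1)[OF g]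
  obtain c where c: "\<And>f t. strain f \<Longrightarrow>
    (\<integral>\<^sup>+s. ennreal (norm (L (t - s) (f s))) \<partial>lborel) \<le> ennreal c * conv (\<lambda>s. ennreal (energy_norm (f s))) t"
    using nn_integral_norm_L_le by metis
  have bl: "bounded_linear (L \<tau>)" for \<tau>
    using linear_L by (simp add: linear_conv_bounded_linear)
  have conv_suminf: "conv (\<lambda>s. \<Sum>n. ennreal (energy_norm (f n s))) t
      = (\<Sum>n. conv (\<lambda>s. ennreal (energy_norm (f n s))) t)"
    unfolding conv_def by (subst nn_integral_suminf[symmetric]) (auto intro!: borel_measurable_times_ennreal)
  have "conv (\<lambda>s. ennreal (energy_norm (f n s))) t < \<infinity>" for n
    using fin unfolding conv_suminf
    by (rule le_less_trans[rotated]) (rule sum_le_suminf[of _ "{n}", simplified], auto)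
  then have int: "integrable lborel (\<lambda>s. L (t - s) (f n s))" for n
    by (intro integrable_L f)
  have AE: "AE s in lborel. summable (\<lambda>n. norm (L (t - s) (f n s))) \<and>
      (\<lambda>n. L (t - s) (f n s)) sums L (t - s) (g s)"
    using sums unfolding AE_history_iff
  proof eventually_elim
    case (elim s)
    show ?case
    proof (cases "s < T")
      case True
      with elim have *: "summable (\<lambda>n. norm (f n s))" "(\<lambda>n. f n s) sums g s" by auto
      obtain b where "\<And>x. norm (L (t - s) x) \<le> norm x * b"
        using bounded_linear.bounded[OF bl] by blast
      then have "summable (\<lambda>n. norm (L (t - s) (f n s)))"
        by (intro summable_comparison_test[OF _ summable_mult2[OF *(1), of b]]) auto
      with * bounded_linear.sums[OF bl] show ?thesis by blast
    next
      case False
      \<comment> \<open>Nothing is known about the series at times \<open>s \<ge> T\<close>, but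
        these lie in the future of \<open>t\<close>, where all terms vanish.\<close>
      then have "t - s < 0" using \<open>t < T\<close> by simp
      then show ?thesis
        by (simp add: L_causal strainD(2)[OF f] strainD(2)[OF g])
    qed
  qed
  have "(\<lambda>n. \<integral>s. L (t - s) (f n s) \<partial>lborel) sums (\<integral>s. (\<Sum>n. L (t - s) (f n s)) \<partial>lborel)"
  proof (rule sums_integral[OF int])
    show "AE s in lborel. summable (\<lambda>n. norm (L (t - s) (f n s)))"
      using AE by eventually_elim blast
    have "(\<Sum>n. ennreal (\<integral>s. norm (L (t - s) (f n s)) \<partial>lborel))
        = (\<Sum>n. \<integral>\<^sup>+s. ennreal (norm (L (t - s) (f n s))) \<partial>lborel)"
      using int by (intro suminf_cong nn_integral_eq_integral[symmetric]) auto
    also have "\<dots> \<le> (\<Sum>n. ennreal c * conv (\<lambda>s. ennreal (energy_norm (f n s))) t)"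
      by (intro suminf_le c f) auto
    also have "\<dots> < \<infinity>"
      using fin unfolding conv_suminf by (simp add: ennreal_mult_less_top)
    finally show "summable (\<lambda>n. \<integral>s. norm (L (t - s) (f n s)) \<partial>lborel)"
      by (intro summable_suminf_not_top) (auto intro: Bochner_Integration.integral_nonneg)
  qed
  also have "(\<integral>s. (\<Sum>n. L (t - s) (f n s)) \<partial>lborel) = (\<integral>s. L (t - s) (g s) \<partial>lborel)"
  proof (rule integral_cong_AE)
    show "AE s in lborel. (\<Sum>n. L (t - s) (f n s)) = L (t - s) (g s)"
      using AE by eventually_elim (auto dest: sums_unique)
  qed measurable
  finally show ?thesis
    unfolding plastic_def .
qed

text \<open>The equation is checked pointwise, at each \<open>t < T\<close> where both the majorant
  \<open>S\<close> and \<open>conv S\<close> are finite. Square integrability of \<open>S\<close>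
  makes almost every \<open>t\<close> of this kind.\<close>

lemma ex_fixed_point:
  assumes f0: "strain f0" "energy f0 < \<infinity>"
  obtains \<epsilon> where "strain \<epsilon>" "energy \<epsilon> < \<infinity>" "AE t in history. \<epsilon> t = f0 t + plastic \<epsilon> t"
proof -
  define f where "f n = (plastic ^^ n) f0" for n
  have f_0: "f 0 = f0" and f_Suc: "f (Suc n) = plastic (f n)" for n
    by (simp_all add: f_def)
  have f: "strain (f n)" for n
    by (induction n) (simp_all add: f_0 f_Suc f0 strain_plastic)
  note [measurable] = strainD(1)[OF f]
  have energy_f: "energy (f n) \<le> (ennreal \<gamma>) ^ (2 * n) * energy f0" for n
  proof (induction n)
    case (Suc n)
    have "energy (f (Suc n)) \<le> (ennreal \<gamma>)\<^sup>2 * energy (f n)"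
      unfolding f_Suc by (rule energy_plastic_le[OF f])
    also have "\<dots> \<le> (ennreal \<gamma>)\<^sup>2 * ((ennreal \<gamma>) ^ (2 * n) * energy f0)"
      using Suc by (intro mult_left_mono) auto
    also have "\<dots> = (ennreal \<gamma>) ^ (2 * Suc n) * energy f0"
      by (simp add: power2_eq_square mult.assoc)
    finally show ?case .
  qed (simp add: f_0)
  define S where "S t = (\<Sum>n. ennreal (energy_norm (f n t)))" for t
  have [measurable]: "S \<in> borel_measurable borel"
    unfolding S_def[abs_def] by measurable
  have S2: "(\<integral>\<^sup>+t. (S t)\<^sup>2 \<partial>history) < \<infinity>"
    unfolding S_def using energy_f f0(2)
    by (intro nn_integral_suminf_square_finite[of _ "energy f0"]) (auto simp: energy_def)
  then have AE_S: "AE t in history. S t < \<infinity>"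
  proof -
    have "AE t in history. (S t)\<^sup>2 \<noteq> \<infinity>"
      using S2 by (intro nn_integral_PInf_AE) auto
    then show ?thesis
      by eventually_elim (auto simp: less_top[symmetric] power_eq_top_ennreal)
  qed
  obtain c where c: "c > 0" "\<And>x. x \<in> V \<Longrightarrow> norm x \<le> c * energy_norm x"
    using norm_le_energy_norm by metis
  have summable_en: "summable (\<lambda>n. energy_norm (f n t))" if "S t < \<infinity>" for t
    using that unfolding S_def
    by (intro summable_suminf_not_top) (auto intro: energy_norm_nonneg strainD(2)[OF f])
  have summable_norm: "summable (\<lambda>n. norm (f n t))" if "S t < \<infinity>" for t
    using c(2)[OF strainD(2)[OF f]]
    by (intro summable_comparison_test[OF _ summable_mult[OF summable_en[OF that], of c]]) auto
  \<comment> \<open>The value 0 on the exceptional set keeps \<epsilon> in \<open>V\<close> and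
    below \<open>S\<close> at every time, not only almost everywhere.\<close>
  define \<epsilon> where "\<epsilon> t = (if S t < \<infinity> then \<Sum>n. f n t else 0)" for t
  have sums_eps: "(\<lambda>n. f n t) sums \<epsilon> t" if "S t < \<infinity>" for t
    using summable_sums[OF summable_norm_cancel[OF summable_norm[OF that]]] that by (simp add: \<epsilon>_def)
  have V_partial: "(\<Sum>i<n. f i t) \<in> V" for n t
    by (intro subspace_sum subspace_V strainD(2)[OF f])
  have eps_V: "\<epsilon> t \<in> V" for t
  proof (cases "S t < \<infinity>")
    case True
    from sums_eps[OF this] show ?thesis
      unfolding sums_def
      by (rule closed_sequentially[OF closed_subspace[OF subspace_V] V_partial])
  qed (simp add: \<epsilon>_def subspace_0[OF subspace_V])
  have eps: "strain \<epsilon>"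
    using eps_V unfolding strain_def \<epsilon>_def[abs_def] by auto
  have eps_le: "ennreal (energy_norm (\<epsilon> t)) \<le> S t" for t
  proof (cases "S t < \<infinity>")
    case True
    have lim: "(\<lambda>n. energy_norm (\<Sum>i<n. f i t)) \<longlonglongrightarrow> energy_norm (\<epsilon> t)"
      using continuous_on_tendsto_compose[OF continuous_on_energy_norm[of UNIV] sums_eps[OF True, unfolded sums_def]]
      by simp
    have le: "energy_norm (\<Sum>i<n. f i t) \<le> (\<Sum>i. energy_norm (f i t))" for n
      using energy_norm_sum_le[of "{..<n}" "\<lambda>i. f i t"] strainD(2)[OF f]
        sum_le_suminf[OF summable_en[OF True], of "{..<n}"] energy_norm_nonneg[OF strainD(2)[OF f]]
      by (meson finite_lessThan order_trans)
    have "energy_norm (\<epsilon> t) \<le> (\<Sum>i. energy_norm (f i t))"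
      by (rule LIMSEQ_le_const2[OF lim]) (use le in blast)
    moreover have "S t = ennreal (\<Sum>i. energy_norm (f i t))"
      unfolding S_def
      by (intro suminf_ennreal2 summable_en[OF True] energy_norm_nonneg strainD(2)[OF f])
    ultimately show ?thesis by (simp add: ennreal_leI)
  qed (simp add: \<epsilon>_def energy_norm_zero)
  have "energy \<epsilon> \<le> (\<integral>\<^sup>+t. (S t)\<^sup>2 \<partial>history)"
    unfolding energy_def by (intro nn_integral_mono power_mono eps_le) auto
  then have fin_eps: "energy \<epsilon> < \<infinity>"
    using S2 by (rule le_less_trans)
  have "AE t in history. conv S t < \<infinity>"
    using S2 by (intro AE_conv_finite) auto
  moreover have "AE t in history. t < T"
    by (simp add: AE_history_iff)
  ultimately have "AE t in history. \<epsilon> t = f0 t + plastic \<epsilon> t"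
    using AE_S
  proof eventually_elim
    case (elim t)
    have "(\<lambda>n. plastic (f n) t) sums plastic \<epsilon> t"
    proof (rule plastic_sums[OF f \<open>t < T\<close> _ _ eps])
      show "conv (\<lambda>s. \<Sum>n. ennreal (energy_norm (f n s))) t < \<infinity>"
        using elim(1) by (simp add: S_def[abs_def])
      show "AE s in history. summable (\<lambda>n. norm (f n s)) \<and> (\<lambda>n. f n s) sums \<epsilon> s"
        using AE_S by eventually_elim (simp add: summable_norm sums_eps)
    qed
    \<comment> \<open>Applying \<open>plastic\<close> shifts the series by one index, so restoring
      the missing term \<open>f 0\<close> recovers the full series for \<epsilon>.\<close>
    then have "(\<lambda>n. f (Suc n) t) sums plastic \<epsilon> t"
      by (simp add: f_Suc)
    then have "(\<lambda>n. f n t) sums (plastic \<epsilon> t + f 0 t)"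
      by (rule sums_Suc)
    then have "\<epsilon> t = plastic \<epsilon> t + f 0 t"
      using sums_unique2[OF sums_eps] elim(3) by blast
    then show ?case
      by (simp add: f_0 add.commute)
  qed
  with eps fin_eps show ?thesis by (rule that)
qed

section \<open>Solution of the variational problem\<close>

lemma variational_solution:
  assumes f0: "strain f0" "energy f0 < \<infinity>"
  obtains \<epsilon> where "strain \<epsilon>" "energy \<epsilon> < \<infinity>"
    "\<And>\<eta>. strain \<eta> \<Longrightarrow> energy \<eta> < \<infinity> \<Longrightarrow>
      strain_inner \<epsilon> \<eta> - strain_inner (plastic \<epsilon>) \<eta> = strain_inner f0 \<eta>"
    "strain_norm \<epsilon> \<le> 1 / (1 - \<gamma>) * strain_norm f0"
proof -
  obtain \<epsilon> where eps: "strain \<epsilon>" "energy \<epsilon> < \<infinity>"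
    and fixp: "AE t in history. \<epsilon> t = f0 t + plastic \<epsilon> t"
    by (rule ex_fixed_point[OF f0])
  note P = strain_plastic[OF eps(1)] energy_plastic_finite[OF eps]
  have eq: "strain_inner \<epsilon> \<eta> - strain_inner (plastic \<epsilon>) \<eta> = strain_inner f0 \<eta>"
    if eta: "strain \<eta>" "energy \<eta> < \<infinity>" for \<eta>
  proof -
    note [measurable] = strainD(1)[OF eps(1)] strainD(1)[OF P(1)] strainD(1)[OF f0(1)] strainD(1)[OF eta(1)]
    have "strain_inner \<epsilon> \<eta> - strain_inner (plastic \<epsilon>) \<eta>
        = (\<integral>t. C (\<epsilon> t) \<bullet> \<eta> t - C (plastic \<epsilon> t) \<bullet> \<eta> t \<partial>history)"
      unfolding strain_inner_def
      by (rule Bochner_Integration.integral_diff[symmetric])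
         (intro strain_inner_Cauchy_Schwarz(1) eps P eta)+
    also have "\<dots> = strain_inner f0 \<eta>"
      unfolding strain_inner_def
    proof (rule integral_cong_AE)
      show "AE t in history. C (\<epsilon> t) \<bullet> \<eta> t - C (plastic \<epsilon> t) \<bullet> \<eta> t = C (f0 t) \<bullet> \<eta> t"
        using fixp
      proof eventually_elim
        case (elim t)
        then have "C (\<epsilon> t) = C (f0 t) + C (plastic \<epsilon> t)"
          by (metis linear_add[OF linear_C])
        then show ?case by (simp add: inner_add_left)
      qed
    qed measurable
    finally show ?thesis .
  qed
  \<comment> \<open>Testing with \<epsilon> itself: coercivity bounds the form from below and
    Cauchy-Schwarz bounds the right side from above. One factor
    \<open>strain_norm \<epsilon>\<close> is cancelled next, with the value 0 treated apart.\<close>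
  have "(1 - \<gamma>) * strain_norm \<epsilon> * strain_norm \<epsilon> \<le> strain_norm f0 * strain_norm \<epsilon>"
    using eq[OF eps] plastic_inner_le[OF eps] strain_inner_Cauchy_Schwarz(2)[OF f0 eps]
      strain_norm_square[OF eps(1)]
    by (simp add: algebra_simps power2_eq_square)
  then have "(1 - \<gamma>) * strain_norm \<epsilon> \<le> strain_norm f0"
    using strain_norm_nonneg[OF eps(1)] strain_norm_nonneg[OF f0(1)]
    by (cases "strain_norm \<epsilon> = 0") auto
  then have "strain_norm \<epsilon> \<le> 1 / (1 - \<gamma>) * strain_norm f0"
    using gamma_less by (simp add: field_simps)
  with eps eq show ?thesis by (rule that)
qed

text \<open>The difference of the solutions is the only test function used, and coercivity forces
  its norm to vanish. Its admissibility is proved here, so \<open>diff\<close> may take it as a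
  premise.\<close>

lemma variational_unique:
  assumes f: "strain f" "energy f < \<infinity>" and g: "strain g" "energy g < \<infinity>"
    and diff: "strain (\<lambda>t. f t - g t) \<Longrightarrow> energy (\<lambda>t. f t - g t) < \<infinity> \<Longrightarrow>
      strain_inner f (\<lambda>t. f t - g t) - strain_inner (plastic f) (\<lambda>t. f t - g t)
      = strain_inner g (\<lambda>t. f t - g t) - strain_inner (plastic g) (\<lambda>t. f t - g t)"
  shows "AE t in history. f t = g t"
proof -
  define d where "d t = f t - g t" for t
  have d_eq: "d = (\<lambda>t. f t - g t)" by (simp add: d_def[abs_def])
  have d: "strain d"
    unfolding d_eq by (rule strain_diff[OF f(1) g(1)])
  note Pf = strain_plastic[OF f(1)] energy_plastic_finite[OF f]
  note Pg = strain_plastic[OF g(1)] energy_plastic_finite[OF g]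
  note CS = strain_inner_Cauchy_Schwarz(1)
  \<comment> \<open>The difference has finite energy because its quadratic form expands into four
    products, each integrable by Cauchy-Schwarz.\<close>
  have "integrable history (\<lambda>t. C (f t) \<bullet> f t - C (f t) \<bullet> g t - C (g t) \<bullet> f t + C (g t) \<bullet> g t)"
    by (intro Bochner_Integration.integrable_add Bochner_Integration.integrable_diff CS f g)
  moreover have "C (f t) \<bullet> f t - C (f t) \<bullet> g t - C (g t) \<bullet> f t + C (g t) \<bullet> g t = C (d t) \<bullet> d t" for t
    by (simp add: d_def linear_diff[OF linear_C] inner_diff algebra_simps)
  ultimately have int_d: "integrable history (\<lambda>t. C (d t) \<bullet> d t)"
    by simp
  then have d_fin: "energy d < \<infinity>"
    using energy_finite_iff[OF d] by blast
  note Pd = strain_plastic[OF d] energy_plastic_finite[OF d d_fin]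
  note [measurable] = strainD(1)[OF d] strainD(1)[OF Pd(1)] strainD(1)[OF Pf(1)] strainD(1)[OF Pg(1)]
  have "C (d t) \<bullet> d t = C (f t) \<bullet> d t - C (g t) \<bullet> d t" for t
    by (simp add: d_def linear_diff[OF linear_C] inner_diff_left)
  then have "strain_inner d d = strain_inner f d - strain_inner g d"
    unfolding strain_inner_def
    by (simp add: Bochner_Integration.integral_diff[OF CS[OF f d d_fin] CS[OF g d d_fin]])
  also have "\<dots> = strain_inner (plastic f) d - strain_inner (plastic g) d"
    using diff d d_fin unfolding d_eq by linarith
  also have "\<dots> = (\<integral>t. C (plastic f t) \<bullet> d t - C (plastic g t) \<bullet> d t \<partial>history)"
    unfolding strain_inner_def
    by (rule Bochner_Integration.integral_diff[symmetric]) (intro CS Pf Pg d d_fin)+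
  also have "\<dots> = strain_inner (plastic d) d"
    unfolding strain_inner_def
  proof (rule integral_cong_AE)
    show "AE t in history. C (plastic f t) \<bullet> d t - C (plastic g t) \<bullet> d t = C (plastic d t) \<bullet> d t"
      using AE_plastic_diff[OF f g] unfolding d_eq[symmetric]
      by eventually_elim (simp add: linear_diff[OF linear_C] inner_diff_left)
  qed measurable
  also have "\<dots> \<le> \<gamma> * strain_inner d d"
    using plastic_inner_le[OF d d_fin] by (simp add: strain_norm_square[OF d])
  finally have "(1 - \<gamma>) * strain_inner d d \<le> 0"
    by (simp add: algebra_simps)
  then have "strain_inner d d = 0"
    using gamma_less strain_inner_self_nonneg[OF d] by (simp add: mult_le_0_iff)
  then have "AE t in history. C (d t) \<bullet> d t = 0"
    unfolding strain_inner_def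
    using integral_nonneg_eq_0_iff_AE[OF int_d] form_nonneg[OF strainD(2)[OF d]] by simp
  then show ?thesis
  proof eventually_elim
    case (elim t)
    then have "d t = 0"
      using C_positive[OF strainD(2)[OF d], of t] by fastforce
    then show ?case by (simp add: d_def)
  qed
qed

end

section \<open>Symmetric matrices\<close>

lemma subspace_Sym3: "subspace Sym3"
  by (auto simp: subspace_def Sym3_def transpose_def vec_eq_iff)

lemma Cinv_eqI:
  assumes "inj_on C Sym3" "x \<in> Sym3"
  shows "Cinv C (C x) = x"
  unfolding Cinv_def using assms by (intro the_equality) (auto dest: inj_onD)

text \<open>A supremum of reals is an upper bound only for a bounded set. The energy unit ball lies
  in a compact Euclidean ball, on which the energy norm of \<open>D (k y)\<close> is bounded;
  scaling \<open>x\<close> to energy norm 1 then gives the estimate.\<close>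

lemma opnormMN_bound:
  assumes C: "strain_space Sym3 C" and inj: "inj_on C Sym3" and onto: "C ` Sym3 = Sym3"
    and k: "linear k" "k ` Sym3 \<subseteq> Sym3" and x: "x \<in> Sym3"
  shows "0 \<le> opnormMN C k"
    and "strain_space.energy_norm C (Cinv C (k x)) \<le> opnormMN C k * strain_space.energy_norm C x"
proof -
  interpret strain_space Sym3 C by fact
  define q where "q y = sqrt (Cinv C (k y) \<bullet> k y)" for y
  define A where "A = {q y | y. y \<in> Sym3 \<and> C y \<bullet> y \<le> 1}"
  have op: "opnormMN C k = Sup A"
    by (simp add: opnormMN_def A_def q_def)
  obtain D where D: "range D \<subseteq> Sym3" "linear D" "\<And>x. x \<in> Sym3 \<Longrightarrow> D (C x) = x"
    using left_inverse by metis
  have Cinv_D: "Cinv C y = D y" "C (D y) = y" if "y \<in> Sym3" for y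
  proof -
    have "y \<in> C ` Sym3" using that by (simp only: onto)
    then obtain z where "z \<in> Sym3" "y = C z" by blast
    then show "Cinv C y = D y" "C (D y) = y" by (simp_all add: D(3) Cinv_eqI[OF inj])
  qed
  have kS: "k y \<in> Sym3" if "y \<in> Sym3" for y using that k(2) by blast
  \<comment> \<open>The stress norm of \<open>k y\<close> equals the strain norm of
    \<open>C^-1 (k y)\<close>, as \<open>C\<close> is an isometry from strains to stresses.\<close>
  have q: "q y = energy_norm (D (k y))" "Cinv C (k y) = D (k y)" if "y \<in> Sym3" for y
    using that by (simp_all add: q_def energy_norm_def Cinv_D kS inner_commute)
  have Dk: "D (k y) \<in> Sym3" for y using D(1) by blast
  obtain c where c: "c > 0" "\<And>x. x \<in> Sym3 \<Longrightarrow> norm x \<le> c * energy_norm x"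
    using norm_le_energy_norm by metis
  have "bdd_above A"
  proof -
    have "compact (energy_norm ` (\<lambda>y. D (k y)) ` cball 0 c)"
      using linear_compose[OF k(1) D(2)]
      by (intro compact_continuous_image compact_cball continuous_on_energy_norm linear_continuous_on)
         (simp_all add: o_def linear_conv_bounded_linear)
    moreover have "A \<subseteq> energy_norm ` (\<lambda>y. D (k y)) ` cball 0 c"
    proof
      fix a assume "a \<in> A"
      then obtain y where y: "a = q y" "y \<in> Sym3" "C y \<bullet> y \<le> 1" by (auto simp: A_def)
      then have "energy_norm y \<le> 1" by (simp add: energy_norm_def)
      then have "c * energy_norm y \<le> c * 1" using c(1) by (intro mult_left_mono) auto
      then have "norm y \<le> c" using c(2)[OF y(2)] by linarith
      then show "a \<in> energy_norm ` (\<lambda>y. D (k y)) ` cball 0 c"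
        using y q by auto
    qed
    ultimately show ?thesis
      by (intro bounded_imp_bdd_above) (rule bounded_subset[OF compact_imp_bounded])
  qed
  then have le: "q y \<le> opnormMN C k" if "y \<in> Sym3" "C y \<bullet> y \<le> 1" for y
    unfolding op using that by (intro cSup_upper) (auto simp: A_def)
  have 0: "0 \<in> Sym3" by (rule subspace_0[OF subspace_Sym3])
  show nonneg: "0 \<le> opnormMN C k"
    using le[OF 0] q(1)[OF 0] energy_norm_nonneg[OF Dk, of 0] by simp
  show "energy_norm (Cinv C (k x)) \<le> opnormMN C k * energy_norm x"
  proof (cases "x = 0")
    case True
    then show ?thesis
      by (simp add: q(2)[OF 0] linear_0[OF k(1)] linear_0[OF D(2)] energy_norm_zero
          Cinv_D(1)[OF 0])
  next
    case False
    define r where "r = energy_norm x"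
    have r: "r > 0"
      using energy_norm_nonneg[OF x] energy_norm_eq_0[OF x] False by (simp add: r_def)
    define y where "y = (1 / r) *\<^sub>R x"
    have y: "y \<in> Sym3" using x by (simp add: y_def subspace_scale[OF subspace_Sym3])
    have "energy_norm y = 1"
      using r by (simp add: y_def energy_norm_scale flip: r_def)
    then have "C y \<bullet> y \<le> 1"
      using energy_norm_square[OF y] by simp
    from le[OF y this] have "energy_norm (D (k y)) \<le> opnormMN C k"
      by (simp add: q(1)[OF y])
    moreover have "D (k y) = (1 / r) *\<^sub>R D (k x)"
      by (simp add: y_def linear_scale[OF k(1)] linear_scale[OF D(2)])
    ultimately show ?thesis
      using r by (simp add: q(2)[OF x] energy_norm_scale field_simps flip: r_def)
  qed
qed

theorem theorem3p1:
  fixes C :: "real^3^3 \<Rightarrow> real^3^3"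
    and K :: "real \<Rightarrow> real^3^3 \<Rightarrow> real^3^3"
    and w :: "real \<Rightarrow> real"
    and T \<gamma> :: real
    and \<sigma> :: "real \<Rightarrow> real^3^3"
  assumes T_pos: "T > 0"
    and C_lin: "linear C" and C_Sym: "\<forall>\<xi>\<in>Sym3. C \<xi> \<in> Sym3"
    and C_symm: "\<forall>\<xi>\<in>Sym3. \<forall>\<eta>\<in>Sym3. C \<xi> \<bullet> \<eta> = \<xi> \<bullet> C \<eta>"
    and C_pos: "\<forall>\<xi>\<in>Sym3. \<xi> \<noteq> 0 \<longrightarrow> C \<xi> \<bullet> \<xi> > 0"
    and K_lin: "\<forall>\<tau>. linear (K \<tau>)" and K_Sym: "\<forall>\<tau>. \<forall>\<xi>\<in>Sym3. K \<tau> \<xi> \<in> Sym3"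
    and K_meas: "\<forall>\<xi>. (\<lambda>\<tau>. K \<tau> \<xi>) \<in> borel_measurable lborel"
    and K_causal: "\<forall>\<tau><0. \<forall>\<xi>\<in>Sym3. K \<tau> \<xi> = 0"
    and K_symm: "\<forall>\<tau>\<ge>0. \<forall>\<xi>\<in>Sym3. \<forall>\<eta>\<in>Sym3. K \<tau> \<xi> \<bullet> \<eta> = \<xi> \<bullet> K \<tau> \<eta>"
    and K_nonneg: "\<forall>\<tau>\<ge>0. \<forall>\<xi>\<in>Sym3. K \<tau> \<xi> \<bullet> \<xi> \<ge> 0"
    and w_pos: "\<forall>t\<ge>0. w t > 0"
    and w_cont: "continuous_on {0..} w"
    and w_noninc: "\<forall>s t. 0 \<le> s \<and> s \<le> t \<longrightarrow> w t \<le> w s"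
    and w_int: "set_integrable lborel {0..} w"
    and w_0: "w 0 = 1"
    and w_semigroup: "\<forall>s t. 0 \<le> t \<and> t \<le> s \<longrightarrow> w s \<ge> w (s - t) * w t"
    and \<gamma>_lt: "\<gamma> < 1"
    and K_int: "set_integrable lborel {0..} (\<lambda>\<tau>. opnormMN C (K \<tau>) / w \<tau>)"
    and K_bound: "(LINT \<tau>:{0..}|lborel. opnormMN C (K \<tau>) / w \<tau>) \<le> \<gamma>"
    and \<sigma>_N: "inN C T w \<sigma>"
  shows "\<exists>\<epsilon>. inM C T w \<epsilon>
           \<and> (\<forall>\<eta>. inM C T w \<eta> \<longrightarrow> aform C K T w \<epsilon> \<eta> = (\<integral>t. \<sigma> t \<bullet> \<eta> t \<partial>mu T w))
           \<and> normM C T w \<epsilon> \<le> 1 / (1 - \<gamma>) * normN C T w \<sigma>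
           \<and> (\<forall>\<epsilon>'. inM C T w \<epsilon>'
                 \<and> (\<forall>\<eta>. inM C T w \<eta> \<longrightarrow> aform C K T w \<epsilon>' \<eta> = (\<integral>t. \<sigma> t \<bullet> \<eta> t \<partial>mu T w))
                 \<longrightarrow> (AE t in mu T w. \<epsilon>' t = \<epsilon> t))"
proof -
  interpret C: strain_space Sym3 C
    using C_symm C_pos by (intro strain_space.intro subspace_Sym3 C_lin) blast+
  obtain D where D: "range D \<subseteq> Sym3" "linear D" "\<And>x. x \<in> Sym3 \<Longrightarrow> D (C x) = x"
    and CD: "\<And>x. x \<in> Sym3 \<Longrightarrow> C (D x) = x"
    using C.left_inverse C_Sym by (metis image_subsetI)
  have D_Sym: "D x \<in> Sym3" for x using D(1) by blast
  have inj: "inj_on C Sym3"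
    using D(3) by (rule inj_on_inverseI)
  have onto: "C ` Sym3 = Sym3"
  proof (intro equalityI subsetI)
    fix y assume "y \<in> Sym3"
    then show "y \<in> C ` Sym3"
      using imageI[OF D_Sym, of C y] by (simp add: CD)
  qed (use C_Sym in blast)
  have Cinv_D: "Cinv C y = D y" if "y \<in> Sym3" for y
    using Cinv_eqI[OF inj D_Sym, of y] that by (simp add: CD)

  define k where "k \<tau> = indicator {0..} \<tau> * opnormMN C (K \<tau>)" for \<tau> :: real
  define h where "h \<tau> = indicator {0..} \<tau> * (opnormMN C (K \<tau>) / w \<tau>)" for \<tau> :: real
  define \<rho> where "\<rho> t = indicator {..<T} t * w (T - t)" for t
  define L where "L \<tau> x = D (K \<tau> x)" for \<tau> x
  have K_img: "K \<tau> ` Sym3 \<subseteq> Sym3" for \<tau> using K_Sym by blast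
  have op_nonneg: "0 \<le> opnormMN C (K \<tau>)" for \<tau>
    by (rule opnormMN_bound(1)[OF C.strain_space_axioms inj onto K_lin[rule_format] K_img
          subspace_0[OF subspace_Sym3]])
  have op_bound: "C.energy_norm (Cinv C (K \<tau> x)) \<le> opnormMN C (K \<tau>) * C.energy_norm x"
    if "x \<in> Sym3" for \<tau> x
    by (rule opnormMN_bound(2)[OF C.strain_space_axioms inj onto K_lin[rule_format] K_img that])
  have w_le_1: "w \<tau> \<le> 1" if "0 \<le> \<tau>" for \<tau>
    using w_noninc w_0 that by (metis order_refl)
  \<comment> \<open>Measurability is known for the weight only on the half-line, through its
    integrability there. The truncation \<open>w'\<close> carries it to \<rho>, and through
    \<open>k = h * w'\<close> to the operator norm of the kernel.\<close>
  define w' where "w' \<tau> = indicator {0..} \<tau> * w \<tau>" for \<tau> :: real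
  have w'_meas [measurable]: "w' \<in> borel_measurable borel"
    using borel_measurable_integrable[OF w_int[unfolded set_integrable_def]]
    by (simp add: w'_def[abs_def])
  have h_int: "integrable lborel h"
    using K_int by (simp add: set_integrable_def h_def[abs_def])
  have h_meas [measurable]: "h \<in> borel_measurable borel"
    using borel_measurable_integrable[OF h_int] by simp
  have k_eq: "k = (\<lambda>\<tau>. h \<tau> * w' \<tau>)"
    using w_pos by (force simp: k_def h_def w'_def split: split_indicator)
  have rho_eq: "\<rho> = (\<lambda>t. indicator {..<T} t * w' (T - t))"
    by (auto simp: \<rho>_def w'_def split: split_indicator)
  have h_nonneg: "0 \<le> h \<tau>" for \<tau>
    using op_nonneg w_pos by (auto simp: h_def less_imp_le split: split_indicator)
  have h_le: "(\<integral>\<tau>. h \<tau> \<partial>lborel) \<le> \<gamma>"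
    using K_bound by (simp add: set_lebesgue_integral_def h_def[abs_def])
  have \<gamma>_nonneg: "0 \<le> \<gamma>"
    by (rule order_trans[OF Bochner_Integration.integral_nonneg h_le]) (rule h_nonneg)
  \<comment> \<open>For \<open>s \<le> t < T\<close> this is the semigroup inequality for the delays
    \<open>T - t\<close> and \<open>t - s\<close>, which add up to \<open>T - s\<close>, multiplied
    by \<open>h (t - s)\<close>. Otherwise the left side is 0.\<close>
  have rho_k: "\<rho> t * k (t - s) \<le> \<rho> s * h (t - s)" for t s
  proof (cases "s \<le> t \<and> t < T")
    case True
    then have "w (T - t) * w (t - s) \<le> w (T - s)"
      using w_semigroup[rule_format, of "t - s" "T - s"] by simp
    from mult_right_mono[OF this h_nonneg[of "t - s"]] show ?thesis
      using True by (simp add: \<rho>_def k_eq w'_def mult_ac)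
  next
    case False
    have "0 \<le> \<rho> s"
      using w_pos by (auto simp: \<rho>_def less_imp_le split: split_indicator)
    then show ?thesis
      using False h_nonneg[of "t - s"] by (auto simp: \<rho>_def k_def split: split_indicator)
  qed
  interpret H: hereditary_law Sym3 C k h \<rho> T \<gamma> L
  proof (intro hereditary_law.intro fading_kernel.intro hereditary_law_axioms.intro)
    show "strain_space Sym3 C" by (rule C.strain_space_axioms)
    show "k \<in> borel_measurable borel"
      unfolding k_eq by measurable
    show "\<rho> \<in> borel_measurable borel"
      unfolding rho_eq by measurable
    show "0 \<le> k \<tau>" for \<tau> by (simp add: k_def op_nonneg)
    show "k \<tau> \<le> h \<tau>" for \<tau>
      using mult_left_mono[OF w_le_1 h_nonneg, of \<tau> \<tau>]
      by (auto simp: k_eq w'_def h_nonneg split: split_indicator)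
    show "\<tau> < 0 \<Longrightarrow> k \<tau> = 0" for \<tau> by (simp add: k_def)
    show "t < T \<Longrightarrow> 0 < \<rho> t" "T \<le> t \<Longrightarrow> \<rho> t = 0" for t
      using w_pos by (simp_all add: \<rho>_def)
    show "(\<integral>\<^sup>+\<tau>. ennreal (h \<tau>) \<partial>lborel) \<le> ennreal \<gamma>"
      using h_int h_nonneg h_le by (simp add: nn_integral_eq_integral ennreal_leI)
    show "linear (L \<tau>)" for \<tau>
      using linear_compose[OF K_lin[rule_format] D(2)] by (simp add: L_def[abs_def] o_def)
    show "L \<tau> x \<in> Sym3" for \<tau> x by (simp add: L_def D_Sym)
    show "(\<lambda>\<tau>. L \<tau> x) \<in> borel_measurable borel" for x
      unfolding L_def by (rule borel_measurable_linear[OF D(2)]) (use K_meas in simp)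
    show "C.energy_norm (L \<tau> x) \<le> k \<tau> * C.energy_norm x" if "x \<in> Sym3" for \<tau> x
    proof (cases "0 \<le> \<tau>")
      case True
      then show ?thesis
        using op_bound[OF that, of \<tau>] Cinv_D K_Sym that by (simp add: L_def k_def)
    next
      case False
      then show ?thesis
        using K_causal that
        by (simp add: L_def k_def linear_0[OF D(2)] C.energy_norm_zero)
    qed
  qed (fact h_meas rho_k \<gamma>_nonneg \<gamma>_lt)+

  have mu: "mu T w = H.history"
    by (simp add: mu_def H.history_def \<rho>_def)
  have inM_iff: "inM C T w f \<longleftrightarrow> H.strain f \<and> H.energy f < \<infinity>" for f
    using H.energy_finite_iff[of f] by (auto simp: inM_def H.strain_def mu)
  have Pop_eq: "Pop C K f = H.plastic f" if "H.strain f" for f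
  proof
    fix t
    \<comment> \<open>The cutoff at \<open>t\<close> is absorbed by causality: beyond it the kernel
      is 0 on symmetric matrices.\<close>
    have "indicator {..t} s *\<^sub>R Cinv C (K (t - s) (f s)) = L (t - s) (f s)" for s
      using H.strainD(2)[OF that, of s] K_Sym K_causal
      by (auto simp: L_def Cinv_D linear_0[OF D(2)] split: split_indicator)
    then show "Pop C K f t = H.plastic f t"
      by (simp add: Pop_def H.plastic_def set_lebesgue_integral_def)
  qed
  have inner_eq: "innerM C T w = H.strain_inner"
    by (intro ext) (simp add: innerM_def H.strain_inner_def mu)
  have norm_eq: "normM C T w = H.strain_norm"
    by (intro ext) (simp add: normM_def H.strain_norm_def inner_eq)
  have aform_eq: "aform C K T w f g = H.strain_inner f g - H.strain_inner (H.plastic f) g"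
    if "H.strain f" for f g
    by (simp add: aform_def inner_eq Pop_eq[OF that])

  \<comment> \<open>The stress is replaced by the strain \<open>C^-1 \<sigma>\<close>. Since
    \<open>C\<close> is an isometry, its norm in \<open>M\<close> is that of \<sigma> in
    \<open>N\<close>, and its inner product with \<open>\<eta>\<close> is the given right
    side.\<close>
  define f0 where "f0 t = D (\<sigma> t)" for t
  have \<sigma>: "\<sigma> \<in> borel_measurable borel" "\<And>t. \<sigma> t \<in> Sym3"
    "integrable (mu T w) (\<lambda>t. Cinv C (\<sigma> t) \<bullet> \<sigma> t)"
    using \<sigma>_N by (auto simp: inN_def)
  have f0_strain: "H.strain f0"
    unfolding H.strain_def f0_def[abs_def] using borel_measurable_linear[OF D(2) \<sigma>(1)] D_Sym by blast
  have C_f0: "C (f0 t) = \<sigma> t" for t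
    by (simp add: f0_def CD \<sigma>(2))
  have Cinv_\<sigma>: "Cinv C (\<sigma> t) = f0 t" for t
    by (simp add: f0_def Cinv_D \<sigma>(2))
  have Cinv_\<sigma>: "Cinv C (\<sigma> t) = f0 t" for t
    by (simp add: f0_def Cinv_D \<sigma>(2))
  have f0_\<sigma>: "C (f0 t) \<bullet> f0 t = Cinv C (\<sigma> t) \<bullet> \<sigma> t" for t
    by (simp add: C_f0 Cinv_\<sigma> inner_commute)
  have f0_energy: "H.energy f0 < \<infinity>"
    using H.energy_finite_iff[OF f0_strain] \<sigma>(3) by (simp add: f0_\<sigma> mu)
  have rhs: "H.strain_inner f0 \<eta> = (\<integral>t. \<sigma> t \<bullet> \<eta> t \<partial>mu T w)" for \<eta>
    by (simp add: H.strain_inner_def C_f0 mu)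
  have normN: "H.strain_norm f0 = normN C T w \<sigma>"
    by (simp add: H.strain_norm_def H.strain_inner_def normN_def f0_\<sigma> mu)

  obtain \<epsilon> where eps: "H.strain \<epsilon>" "H.energy \<epsilon> < \<infinity>"
    and sol: "\<And>\<eta>. H.strain \<eta> \<Longrightarrow> H.energy \<eta> < \<infinity> \<Longrightarrow>
      H.strain_inner \<epsilon> \<eta> - H.strain_inner (H.plastic \<epsilon>) \<eta> = H.strain_inner f0 \<eta>"
    and bound: "H.strain_norm \<epsilon> \<le> 1 / (1 - \<gamma>) * H.strain_norm f0"
    using H.variational_solution[OF f0_strain f0_energy] by metis
  show ?thesis
  proof (intro exI[of _ \<epsilon>] conjI allI impI)
    show "inM C T w \<epsilon>"
      using eps by (simp add: inM_iff)
    show "aform C K T w \<epsilon> \<eta> = (\<integral>t. \<sigma> t \<bullet> \<eta> t \<partial>mu T w)" if "inM C T w \<eta>" for \<eta>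
      using that sol[of \<eta>] by (simp add: inM_iff aform_eq eps rhs)
    show "normM C T w \<epsilon> \<le> 1 / (1 - \<gamma>) * normN C T w \<sigma>"
      using bound by (simp only: norm_eq normN)
    fix \<epsilon>'
    assume *: "inM C T w \<epsilon>' \<and>
      (\<forall>\<eta>. inM C T w \<eta> \<longrightarrow> aform C K T w \<epsilon>' \<eta> = (\<integral>t. \<sigma> t \<bullet> \<eta> t \<partial>mu T w))"
    then have eps': "H.strain \<epsilon>'" "H.energy \<epsilon>' < \<infinity>"
      and sol': "\<And>\<eta>. inM C T w \<eta> \<Longrightarrow> aform C K T w \<epsilon>' \<eta> = (\<integral>t. \<sigma> t \<bullet> \<eta> t \<partial>mu T w)"
      by (auto simp: inM_iff)
    show "AE t in mu T w. \<epsilon>' t = \<epsilon> t"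
      unfolding mu
    proof (rule H.variational_unique[OF eps' eps])
      assume d: "H.strain (\<lambda>t. \<epsilon>' t - \<epsilon> t)" "H.energy (\<lambda>t. \<epsilon>' t - \<epsilon> t) < \<infinity>"
      then show "H.strain_inner \<epsilon>' (\<lambda>t. \<epsilon>' t - \<epsilon> t) - H.strain_inner (H.plastic \<epsilon>') (\<lambda>t. \<epsilon>' t - \<epsilon> t)
        = H.strain_inner \<epsilon> (\<lambda>t. \<epsilon>' t - \<epsilon> t) - H.strain_inner (H.plastic \<epsilon>) (\<lambda>t. \<epsilon>' t - \<epsilon> t)"
        using sol'[of "\<lambda>t. \<epsilon>' t - \<epsilon> t"] by (simp add: sol[OF d] rhs inM_iff aform_eq eps')
    qed
  qed
qed

end
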